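(* Let $X(\mathbb{R}^n)$ be a quasi-sBfs with quasi-norm $\|\cdot\|_X$. Let $\phi:\mathbb{R}^n\times(0,\infty)\to(0,\infty)$ satisfy the following two conditions: (a) there is a constant $C>0$ such that $\phi(x,r)\le C\phi(x,s)$ for all $x\in\mathbb{R}^n$ and all $r\ge s>0$; (b) there is a constant $C\ge 1$ such that $\frac1C\le\frac{\phi(x,r)}{\phi(y,r)}\le C$ for all $x,y\in\mathbb{R}^n$ and $r>0$ with $|x-y|\le r$. Let $f\in L^1_{\rm loc}(\mathbb{R}^n)$. Then the following assertions hold: (1) If there exists $C>0$ such that $\|\chi_Q\|_X\|\chi_Q\|_{X'}\le C|Q|$ for all $Q\in\mathcal{Q}(\mathbb{R}^n)$, then there exists $C>0$, independent of $f$, such that $$\|f\|_{\mathcal{L}_{1,\phi}}\le C\sup_{Q\in\mathcal{Q}}\phi(Q)\frac{\|(f-f_Q)\chi_Q\|_X}{\|\chi_Q\|_X}.$$ (2) If there exist $\eta>1$ and $C>0$ such that for all sequences $\{f_j\}_{j\in\mathbb{Z}}\subset L^0(\mathbb{R}^n)$, $$\left\|\sum_{j\in\mathbb{Z}}(Mf_j)^\eta\right\|_X\le C\left\|\sum_{j\in\mathbb{Z}}|f_j|^\eta\right\|_X,$$ then there exists $C>0$, independent of $f$, such that $$\sup_{Q\in\mathcal{Q}}\phi(Q)\frac{\|(f-f_Q)\chi_Q\|_X}{\|\chi_Q\|_X}\le C\|f\|_{\mathcal{L}_{1,\phi}}.$$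
   Context: $L^0(\mathbb{R}^n)$ is the space of all measurable functions on $\mathbb{R}^n$ (identified when equal a.e.); $L^1_{\rm loc}(\mathbb{R}^n)$ is the space of functions integrable on every compact set. $\mathcal{Q}=\mathcal{Q}(\mathbb{R}^n)$ is the collection of all cubes with sides parallel to the coordinate axes, written $Q=Q(x,r)=x+[-r,r)^n$ with $x\in\mathbb{R}^n$, $r>0$, and $\phi(Q)=\phi(x,r)$. $\chi_E$ is the characteristic function of $E$, and $f_Q=\frac1{|Q|}\int_Q f(x)\,dx$. A quasi-sBfs is a quasi-Banach space $X(\mathbb{R}^n)=(X(\mathbb{R}^n),\|\cdot\|_X)$ contained in $L^0(\mathbb{R}^n)$ such that: (i) if $f\in X(\mathbb{R}^n)$ and $g\in L^0(\mathbb{R}^n)$ with $|g|\le|f|$, then $g\in X(\mathbb{R}^n)$ and $\|g\|_X\le\|f\|_X$; (iii)'' for every cube $Q\in\mathcal{Q}(\mathbb{R}^n)$, $\|\chi_Q\|_X<\infty$ (i.e. $\chi_Q\in X(\mathbb{R}^n)$). Convention: $\|g\|_X=\infty$ when $g\notin X(\mathbb{R}^n)$ (in particular when $g$ is infinite on a set of positive measure). The associate functional is $\|f\|_{X'}=\sup\{\int_{\mathbb{R}^n}|f(x)g(x)|\,dx: g\in X(\mathbb{R}^n),\ \|g\|_X\le1\}$. The Hardy–Littlewood maximal operator is $Mf(x)=\sup_{Q\in\mathcal{Q}}\frac{\chi_Q(x)}{|Q|}\int_Q|f(y)|\,dy$ for $f\in L^0(\mathbb{R}^n)$. The Campanato norm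 is $\|f\|_{\mathcal{L}_{1,\phi}}=\sup_{Q\in\mathcal{Q}}\phi(Q)\frac1{|Q|}\int_Q|f(x)-f_Q|\,dx$. All suprema may be $+\infty$. *)

theory Defs
  imports "HOL-Analysis.Analysis"
begin

text \<open>
  The scalar sort \<open>{real_normed_field, euclidean_space}\<close> has the instances \<open>real\<close> and \<open>complex\<close>,
  so real- and complex-valued functions are treated simultaneously. ``Measurable'' means Lebesgue
  measurable. Elements of \<open>L\<^sup>0\<close> are represented by functions rather than by classes modulo almost
  everywhere equality.
\<close>

definition L0 :: "(real ^ 'n \<Rightarrow> 'k::{real_normed_field, euclidean_space}) set" where
  "L0 = borel_measurable lebesgue"

definition L1_loc :: "(real ^ 'n \<Rightarrow> 'k::{real_normed_field, euclidean_space}) set" where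
  "L1_loc = {f. \<forall>K. compact K \<longrightarrow> set_integrable lebesgue K f}"

definition cube :: "real ^ 'n \<Rightarrow> real \<Rightarrow> (real ^ 'n) set" where
  "cube x r = {y. \<forall>i. x $ i - r \<le> y $ i \<and> y $ i < x $ i + r}"

definition cubes :: "(real ^ 'n) set set" where
  "cubes = {cube x r |x r. r > 0}"

definition avg :: "(real ^ 'n) set \<Rightarrow> (real ^ 'n \<Rightarrow> 'k::{real_normed_field, euclidean_space}) \<Rightarrow> 'k" where
  "avg Q f = (1 / measure lebesgue Q) *\<^sub>R (LINT y:Q|lebesgue. f y)"

text \<open>
  A quasi-normed function space is given by its carrier \<open>X\<close> and its quasi-norm \<open>N\<close>, of which only
  the values on \<open>X\<close> matter. Where \<open>ideal\<close> below is also assumed, \<open>X\<close> and \<open>N\<close> respect almost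
  everywhere equality.
\<close>

locale quasi_Banach_L0 =
  fixes X :: "(real ^ 'n \<Rightarrow> 'k::{real_normed_field, euclidean_space}) set"
    and N :: "(real ^ 'n \<Rightarrow> 'k) \<Rightarrow> real"
  assumes subset_L0: "X \<subseteq> L0"
    and zero_mem: "(\<lambda>x. 0) \<in> X"
    and add_mem: "f \<in> X \<Longrightarrow> g \<in> X \<Longrightarrow> (\<lambda>x. f x + g x) \<in> X"
    and scale_mem: "f \<in> X \<Longrightarrow> (\<lambda>x. c * f x) \<in> X"
    and norm_nonneg: "f \<in> X \<Longrightarrow> 0 \<le> N f"
    and norm_eq_zero: "f \<in> X \<Longrightarrow> N f = 0 \<longleftrightarrow> (AE x in lebesgue. f x = 0)"
    and norm_scale: "f \<in> X \<Longrightarrow> N (\<lambda>x. c * f x) = norm c * N f"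
    and quasi_triangle:
      "\<exists>K\<ge>1. \<forall>f\<in>X. \<forall>g\<in>X. N (\<lambda>x. f x + g x) \<le> K * (N f + N g)"
    and complete:
      "(\<And>j. u j \<in> X) \<Longrightarrow>
       (\<And>e. e > 0 \<Longrightarrow> \<exists>M. \<forall>j\<ge>M. \<forall>k\<ge>M. N (\<lambda>x. u j x - u k x) < e) \<Longrightarrow>
       \<exists>f\<in>X. (\<lambda>j. N (\<lambda>x. u j x - f x)) \<longlonglongrightarrow> 0"

locale quasi_sBfs = quasi_Banach_L0 +
  assumes ideal:
      "f \<in> X \<Longrightarrow> g \<in> L0 \<Longrightarrow> (AE x in lebesgue. norm (g x) \<le> norm (f x)) \<Longrightarrow>
       g \<in> X \<and> N g \<le> N f"
    and indicator_mem: "Q \<in> cubes \<Longrightarrow> indicator Q \<in> X"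

definition xnorm ::
  "(real ^ 'n \<Rightarrow> 'k::{real_normed_field, euclidean_space}) set \<Rightarrow> ((real ^ 'n \<Rightarrow> 'k) \<Rightarrow> real)
   \<Rightarrow> (real ^ 'n \<Rightarrow> 'k) \<Rightarrow> ennreal" where
  "xnorm X N f = (if f \<in> X then ennreal (N f) else \<infinity>)"

text \<open>
  The same norm for a function with values in \<open>[0, \<infinity>]\<close>, such as a maximal function. Note that
  \<open>enn2real \<infinity> = 0\<close>, which here only affects a null set.
\<close>

definition xnorm_enn ::
  "(real ^ 'n \<Rightarrow> 'k::{real_normed_field, euclidean_space}) set \<Rightarrow> ((real ^ 'n \<Rightarrow> 'k) \<Rightarrow> real)
   \<Rightarrow> (real ^ 'n \<Rightarrow> ennreal) \<Rightarrow> ennreal" where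
  "xnorm_enn X N g =
     (if AE x in lebesgue. g x < \<infinity> then xnorm X N (\<lambda>x. of_real (enn2real (g x))) else \<infinity>)"

definition assoc_norm ::
  "(real ^ 'n \<Rightarrow> 'k::{real_normed_field, euclidean_space}) set \<Rightarrow> ((real ^ 'n \<Rightarrow> 'k) \<Rightarrow> real)
   \<Rightarrow> (real ^ 'n \<Rightarrow> 'k) \<Rightarrow> ennreal" where
  "assoc_norm X N f =
     (SUP g\<in>{g\<in>X. N g \<le> 1}. \<integral>\<^sup>+x. ennreal (norm (f x * g x)) \<partial>lebesgue)"

definition maximal ::
  "(real ^ 'n \<Rightarrow> 'k::{real_normed_field, euclidean_space}) \<Rightarrow> real ^ 'n \<Rightarrow> ennreal" where
  "maximal f x =
     (SUP Q\<in>cubes. indicator Q x / emeasure lebesgue Q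
        * (\<integral>\<^sup>+y\<in>Q. ennreal (norm (f y)) \<partial>lebesgue))"

definition enn_powr :: "ennreal \<Rightarrow> real \<Rightarrow> ennreal" where  \<comment> \<open>for positive exponents\<close>
  "enn_powr a p = (if a = \<infinity> then \<infinity> else ennreal (enn2real a powr p))"

definition campanato_norm ::
  "(real ^ 'n \<Rightarrow> real \<Rightarrow> real) \<Rightarrow> (real ^ 'n \<Rightarrow> 'k::{real_normed_field, euclidean_space}) \<Rightarrow> ennreal"
where
  "campanato_norm \<phi> f =
     (SUP (x, r)\<in>UNIV \<times> {0<..}.
        ennreal (\<phi> x r) * (1 / emeasure lebesgue (cube x r))
        * (\<integral>\<^sup>+y\<in>cube x r. ennreal (norm (f y - avg (cube x r) f)) \<partial>lebesgue))"

definition X_campanato_norm ::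
  "(real ^ 'n \<Rightarrow> 'k::{real_normed_field, euclidean_space}) set \<Rightarrow> ((real ^ 'n \<Rightarrow> 'k) \<Rightarrow> real)
   \<Rightarrow> (real ^ 'n \<Rightarrow> real \<Rightarrow> real) \<Rightarrow> (real ^ 'n \<Rightarrow> 'k) \<Rightarrow> ennreal" where
  "X_campanato_norm X N \<phi> f =
     (SUP (x, r)\<in>UNIV \<times> {0<..}.
        ennreal (\<phi> x r)
        * (xnorm X N (\<lambda>y. (f y - avg (cube x r) f) * indicator (cube x r) y)
           / xnorm X N (indicator (cube x r))))"

end

theory Submission
  imports Defs
begin

text \<open>
  The inequality of the first part is duality: on a cube \<open>Q\<close> the integral of \<open>\<bar>f - f\<^sub>Q\<bar>\<close> is a pairing with
  \<open>\<chi>\<^sub>Q\<close>, hence at most \<open>\<parallel>(f - f\<^sub>Q) \<chi>\<^sub>Q\<parallel>\<^sub>X \<parallel>\<chi>\<^sub>Q\<parallel>\<^sub>X\<^sub>'\<close>, and the hypothesis trades the second factor for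
  \<open>C \<bar>Q\<bar> / \<parallel>\<chi>\<^sub>Q\<parallel>\<^sub>X\<close> (lemma \<open>campanato_le_X_campanato\<close>).

  The second part is a John--Nirenberg argument in which the maximal inequality replaces the
  exponential integrability. Fix a cube \<open>Q\<close> and its dyadic subcubes. As \<open>\<phi>\<close> is almost decreasing under
  passing to larger cubes, finiteness of the Campanato norm bounds the mean oscillation of \<open>f\<close> over every
  dyadic subcube of \<open>Q\<close> by one number \<open>d\<close>, a constant times \<open>\<parallel>f\<parallel> / \<phi>(Q)\<close>. Follow the averages of \<open>f\<close>
  over the dyadic cubes shrinking to a point \<open>y\<close>, remember a reference value, and update it whenever the
  current average is more than \<open>2 d\<close> away from it. Each update moves the reference value by at most
  \<open>(2 + 2\<^sup>n) d\<close>, because the averages over a cube and over one of its dyadic children differ by at most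
  \<open>2\<^sup>n d\<close>. So the averages stay within \<open>(2 + 2\<^sup>n) d\<close> times the number of reference values used
  at \<open>y\<close>, and by differentiation the same holds for \<open>f\<close> itself almost everywhere.

  Let \<open>L\<^sub>k\<close> be the set where more than \<open>k\<close> reference values are used, so that this number is
  the sum over \<open>k\<close> of the indicators of the \<open>L\<^sub>k\<close>. The set \<open>L\<^sub>k\<close> is a union of dyadic cubes \<open>R\<close> on
  which the \<open>(k+1)\<close>-st value is taken up, and by the weak type inequality at height \<open>2 d\<close> at most half
  of such an \<open>R\<close> belongs to \<open>L\<^sub>k\<^sub>+\<^sub>1\<close>. Thus the maximal function of the indicator of the layer
  \<open>L\<^sub>k - L\<^sub>k\<^sub>+\<^sub>1\<close> is at least \<open>1/2\<close> on all of \<open>L\<^sub>k\<close>. The layers are disjoint subsets of \<open>Q\<close>, so the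
  vector-valued maximal inequality, applied once, bounds the \<open>X\<close>-norm of the number of reference
  values by a constant times \<open>\<parallel>\<chi>\<^sub>Q\<parallel>\<^sub>X\<close>
  (lemmas \<open>mean_le_cnt\<close>, \<open>maximal_layer_ge\<close>, \<open>X_oscillation_le\<close>).
\<close>

section \<open>Cubes and dyadic grids\<close>

lemma sets_cube [measurable, simp]: "cube (x :: real ^ 'n) r \<in> sets lebesgue"
proof -
  have "cube x r = (\<Inter>i. {y. x $ i - r \<le> y $ i} \<inter> {y. y $ i < x $ i + r})"
    by (auto simp: cube_def)
  also have "\<dots> \<in> sets borel"
    by (intro sets.countable_INT'' sets.Int borel_closed borel_open closed_Collect_le open_Collect_less
        continuous_intros countable_finite) auto
  finally show ?thesis by simp
qed

lemma emeasure_cube: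
  fixes x :: "real ^ 'n"
  assumes "r > 0"
  shows "emeasure lebesgue (cube x r) = ennreal ((2 * r) ^ CARD('n))"
proof (rule antisym)
  let ?a = "\<chi> i. x $ i - r" and ?b = "\<chi> i. x $ i + r"
  have ne: "cbox ?a ?b \<noteq> {}"
    using assms by (auto simp: interval_ne_empty_cart)
  have content: "measure lborel (cbox ?a ?b) = (2 * r) ^ CARD('n)"
    using content_cbox_cart[OF ne] by simp
  then have e: "emeasure lebesgue (cbox ?a ?b) = ennreal ((2 * r) ^ CARD('n))"
    using emeasure_eq_ennreal_measure[of lborel "cbox ?a ?b"] emeasure_lborel_cbox_finite[of ?a ?b] by simp
  have "emeasure lborel (box ?a ?b) = emeasure lborel (cbox ?a ?b)"
    unfolding emeasure_lborel_box_eq emeasure_lborel_cbox_eq ..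
  with e have e': "emeasure lebesgue (box ?a ?b) = ennreal ((2 * r) ^ CARD('n))"
    by simp
  have "cube x r \<subseteq> cbox ?a ?b" and sub: "box ?a ?b \<subseteq> cube x r"
    by (auto simp: cube_def mem_box_cart less_imp_le)
  then show "emeasure lebesgue (cube x r) \<le> ennreal ((2 * r) ^ CARD('n))"
    unfolding e[symmetric] by (intro emeasure_mono) auto
  show "ennreal ((2 * r) ^ CARD('n)) \<le> emeasure lebesgue (cube x r)"
    unfolding e'[symmetric] using sub by (intro emeasure_mono) auto
qed

text \<open>
  The dyadic cubes of generation \<open>m\<close> are the fibres of an integer-valued index map. Membership in a cell
  is then equality of indices, so that the partition property is immediate; the geometry enters only
  through \<open>cell_0\<close>, \<open>cell_is_cube\<close> and \<open>cell_Suc_subset\<close>.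
\<close>

locale dyadic_grid =
  fixes x0 :: "real ^ 'n" and r :: real
  assumes r_pos: "r > 0"
begin

definition idx :: "nat \<Rightarrow> real ^ 'n \<Rightarrow> int ^ 'n" where
  "idx m y = (\<chi> i. \<lfloor>(y $ i - (x0 $ i - r)) / (2 * r) * 2 ^ m\<rfloor>)"

definition cell :: "nat \<Rightarrow> real ^ 'n \<Rightarrow> (real ^ 'n) set" where
  "cell m y = {z. idx m z = idx m y}"

lemma self_in_cell [simp]: "y \<in> cell m y"
  by (simp add: cell_def)

lemma cell_eq: "z \<in> cell m y \<Longrightarrow> cell m z = cell m y"
  by (simp add: cell_def)

lemma cell_is_cube: "\<exists>c. cell m y = cube c (r / 2 ^ m)"
proof -
  define s where "s = r / 2 ^ m"
  have s: "s > 0" "t / (2 * r) * 2 ^ m = t / (2 * s)" for t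
    using r_pos by (auto simp: s_def)
  define c where "c = (\<chi> i. x0 $ i - r + (2 * real_of_int (idx m y $ i) + 1) * s)"
  have "\<lfloor>(z - a) / (2 * s)\<rfloor> = k \<longleftrightarrow>
      a + (2 * real_of_int k + 1) * s - s \<le> z \<and> z < a + (2 * real_of_int k + 1) * s + s" for z a k
    using s(1) unfolding floor_eq_iff by (auto simp: field_simps)
  moreover have ix: "idx m z $ i = \<lfloor>(z $ i - (x0 $ i - r)) / (2 * s)\<rfloor>" for z i
    unfolding idx_def s(2) by simp
  ultimately have "cell m y = cube c s"
    unfolding cell_def vec_eq_iff by (simp add: cube_def c_def ix)
  then show ?thesis unfolding s_def ..
qed

lemma cell_0: assumes "y \<in> cube x0 r" shows "cell 0 y = cube x0 r"
proof -
  have "\<lfloor>(z - (a - r)) / (2 * r)\<rfloor> = 0 \<longleftrightarrow> a - r \<le> z \<and> z < a + r" for z a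
    using r_pos unfolding floor_eq_iff by (auto simp: field_simps)
  then have iff: "idx 0 z = 0 \<longleftrightarrow> z \<in> cube x0 r" for z
    by (simp only: idx_def vec_eq_iff cube_def vec_lambda_beta power_0 mult_1_right zero_index
        mem_Collect_eq)
  from assms have y: "idx 0 y = 0"
    by (simp only: iff)
  show ?thesis
    unfolding cell_def y iff by simp
qed

lemma cell_Suc_subset: "cell (Suc m) y \<subseteq> cell m y"
proof -
  have "\<lfloor>t * 2 ^ m\<rfloor> = \<lfloor>t * 2 ^ Suc m\<rfloor> div 2" for t :: real
    using floor_divide_real_eq_div[of 2 "t * 2 ^ Suc m"] by simp
  then have "idx m z = (\<chi> i. idx (Suc m) z $ i div 2)" for z
    unfolding idx_def vec_eq_iff by (simp only: vec_lambda_beta simp_thms)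
  then show ?thesis
    unfolding cell_def by (intro Collect_mono) simp
qed

lemma cell_antimono: "m \<le> m' \<Longrightarrow> cell m' y \<subseteq> cell m y"
  by (induction rule: dec_induct) (use cell_Suc_subset in blast)+

lemma sets_cell [measurable, simp]: "cell m y \<in> sets lebesgue"
  using cell_is_cube[of m y] by auto

lemma emeasure_cell: "emeasure lebesgue (cell m y) = ennreal ((2 * r / 2 ^ m) ^ CARD('n))"
  using cell_is_cube[of m y] emeasure_cube[of "r / 2 ^ m"] r_pos by auto

lemma countable_cells: "countable (\<Union>m. range (cell m))"
proof (rule countable_UN)
  fix m :: nat
  have "cell m = (\<lambda>k. {z. idx m z = k}) \<circ> idx m"
    by (simp add: fun_eq_iff cell_def)
  then have "range (cell m) = (\<lambda>k. {z. idx m z = k}) ` range (idx m)"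
    by (simp only: image_comp)
  then show "countable (range (cell m))"
    by (simp only: countable_image countableI_type)
qed simp

lemma sets_saturated:
  assumes "\<And>y z. z \<in> cell m y \<Longrightarrow> y \<in> A \<Longrightarrow> z \<in> A"
  shows "A \<in> sets lebesgue"
proof -
  have "A = \<Union>(cell m ` A)"
    using assms self_in_cell by fast
  moreover have "countable (cell m ` A)"
    by (rule countable_subset[OF _ countable_cells]) auto
  ultimately show ?thesis
    using sets.countable_Union[of "cell m ` A" lebesgue] sets_cell by force
qed

text \<open>
  The stopping time principle: the maximal cells with property \<open>P\<close> form a countable partition of the
  set where some cell has \<open>P\<close>, so that a comparison of two measures on single cells adds up. It yields the
  weak type inequality and the differentiation theorem below.
\<close>

lemma stopping_cells:
  fixes P :: "nat \<Rightarrow> real ^ 'n \<Rightarrow> bool"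
  assumes sat: "\<And>m y z. z \<in> cell m y \<Longrightarrow> P m y \<Longrightarrow> P m z"
    and "sets M = sets lebesgue" "sets M' = sets lebesgue"
    and le: "\<And>m y. P m y \<Longrightarrow> emeasure M (cell m y) \<le> emeasure M' (cell m y)"
  shows "{y. \<exists>m. P m y} \<in> sets lebesgue"
    and "emeasure M {y. \<exists>m. P m y} \<le> emeasure M' {y. \<exists>m. P m y}"
proof -
  let ?B = "{y. \<exists>m. P m y}"
  (* cell (l y) y is the largest cell containing y with property P *)
  define l where "l y = (LEAST m. P m y)" for y
  define I where "I = (\<lambda>y. cell (l y) y) ` ?B"
  have Pl: "P (l y) y" if "y \<in> ?B" for y
    using that unfolding l_def by (auto intro: LeastI)
  have ll: "l y \<le> m" if "P m y" for y m
    using that unfolding l_def by (rule Least_le)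
  have l_eq: "l v = l y" if "y \<in> ?B" "v \<in> cell (l y) y" for v y
  proof (rule antisym)
    show le: "l v \<le> l y" by (intro ll sat[OF that(2)] Pl that)
    have "y \<in> cell (l v) v"
      using that(2) cell_antimono[OF le, of v] by (auto simp: cell_def)
    moreover have "P (l v) v"
      using sat[OF that(2) Pl[OF that(1)]] by (intro Pl) auto
    ultimately show "l y \<le> l v" by (intro ll) (rule sat)
  qed
  have cell_v: "cell (l v) v = C" if "C \<in> I" "v \<in> C" for v C
  proof -
    from that obtain y where "y \<in> ?B" "C = cell (l y) y"
      by (auto simp: I_def)
    with that l_eq[of y v] show ?thesis
      by (simp add: cell_eq)
  qed
  then have disj: "disjoint_family_on (\<lambda>C. C) I"
    unfolding disjoint_family_on_def by blast
  have "P (l y) v" if "P m y" "v \<in> cell (l y) y" for m y v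
    using sat[OF that(2)] Pl that(1) by blast
  then have un: "?B = \<Union>((\<lambda>C. C) ` I)"
    unfolding I_def using self_in_cell by fast
  have count: "countable I"
    by (rule countable_subset[OF _ countable_cells]) (auto simp: I_def)
  have meas: "C \<in> sets lebesgue" if "C \<in> I" for C
    using that by (auto simp: I_def)
  show "?B \<in> sets lebesgue"
    unfolding un using count meas by (intro sets.countable_UN') auto
  have sum: "emeasure M0 ?B = (\<integral>\<^sup>+C. emeasure M0 C \<partial>count_space I)"
    if "sets M0 = sets lebesgue" for M0
    unfolding un using meas that by (intro emeasure_UN_countable count disj) simp
  have "emeasure M C \<le> emeasure M' C" if "C \<in> I" for C
    using that le Pl unfolding I_def by blast
  then show "emeasure M ?B \<le> emeasure M' ?B"
    unfolding sum[OF assms(2)] sum[OF assms(3)] by (intro nn_integral_mono) simp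
qed

lemma cell_subset_cube: "y \<in> cube x0 r \<Longrightarrow> cell m y \<subseteq> cube x0 r"
  using cell_antimono[of 0 m y] cell_0 by simp

lemma cell_in_open:
  assumes "open W" "y \<in> W"
  shows "\<exists>m. cell m y \<subseteq> W"
proof -
  obtain e where e: "e > 0" "ball y e \<subseteq> W"
    using assms open_contains_ball by blast
  define n where "n = real CARD('n)"
  have n: "n > 0" by (simp add: n_def)
  obtain m where m: "(1/2) ^ m < e / (n * (2 * r))"
    using real_arch_pow_inv[of "e / (n * (2 * r))" "1/2"] e n r_pos by auto
  then have small: "n * (2 * (r / 2 ^ m)) < e"
    using n r_pos by (simp add: field_simps power_one_over)
  obtain c where c: "cell m y = cube c (r / 2 ^ m)"
    using cell_is_cube by blast
  have "dist y z < e" if "z \<in> cell m y" for z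
  proof -
    have "\<bar>(y - z) $ i\<bar> \<le> 2 * (r / 2 ^ m)" for i
    proof -
      have "c $ i - r / 2 ^ m \<le> z $ i \<and> z $ i < c $ i + r / 2 ^ m"
        "c $ i - r / 2 ^ m \<le> y $ i \<and> y $ i < c $ i + r / 2 ^ m"
        using that self_in_cell[of y m] unfolding c by (auto simp: cube_def)
      then show ?thesis unfolding vector_minus_component by linarith
    qed
    then have "(\<Sum>i\<in>UNIV. \<bar>(y - z) $ i\<bar>) \<le> (\<Sum>i\<in>(UNIV :: 'n set). 2 * (r / 2 ^ m))"
      by (intro sum_mono)
    then have "norm (y - z) \<le> n * (2 * (r / 2 ^ m))"
      using norm_le_l1_cart[of "y - z"] by (simp add: n_def)
    with small show ?thesis by (simp add: dist_norm)
  qed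
  then have "cell m y \<subseteq> W"
    using e(2) by auto
  then show ?thesis ..
qed

definition mean :: "(real ^ 'n \<Rightarrow> 'k::{real_normed_field, euclidean_space}) \<Rightarrow> nat \<Rightarrow> real ^ 'n \<Rightarrow> 'k"
  where "mean f m y = avg (cell m y) f"

lemma mean_cell: "z \<in> cell m y \<Longrightarrow> mean f m z = mean f m y"
  by (simp add: mean_def cell_eq)

end

section \<open>Dyadic averages\<close>

lemma norm_avg_le:
  fixes f :: "real ^ 'n \<Rightarrow> 'k::{real_normed_field, euclidean_space}"
  assumes "A \<in> sets lebesgue" "0 < emeasure lebesgue A" "emeasure lebesgue A < \<infinity>"
    and int: "set_integrable lebesgue A f"
  shows "ennreal (norm (avg A f - c)) * emeasure lebesgue A
    \<le> (\<integral>\<^sup>+y\<in>A. ennreal (norm (f y - c)) \<partial>lebesgue)"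
proof -
  let ?m = "measure lebesgue A"
  have em: "emeasure lebesgue A = ennreal ?m"
    using assms(3) by (simp add: emeasure_eq_ennreal_measure)
  then have m: "?m > 0"
    using assms(2) by (metis ennreal_0 measure_nonneg order_less_le)
  have intc: "set_integrable lebesgue A (\<lambda>y. c)"
    using assms(1,3) by (simp add: set_integrable_def)
  have "(LINT y:A|lebesgue. f y - c) = (LINT y:A|lebesgue. f y) - (LINT y:A|lebesgue. c)"
    by (rule set_integral_diff(2)[OF int intc])
  also have "(LINT y:A|lebesgue. c) = ?m *\<^sub>R c"
    using assms(1,3) by (simp add: set_lebesgue_integral_def)
  also have "(LINT y:A|lebesgue. f y) = ?m *\<^sub>R avg A f"
    using m by (simp add: avg_def)
  finally have "norm (LINT y:A|lebesgue. f y - c) = norm (avg A f - c) * ?m"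
    using m by (metis abs_of_pos mult.commute norm_scaleR scaleR_right_diff_distrib)
  then have "ennreal (norm (avg A f - c)) * emeasure lebesgue A =
      ennreal (norm (LINT y:A|lebesgue. f y - c))"
    by (simp add: em ennreal_mult')
  also have "\<dots> \<le> (\<integral>\<^sup>+y. ennreal (norm (indicator A y *\<^sub>R (f y - c))) \<partial>lebesgue)"
    unfolding set_lebesgue_integral_def
    using set_integral_diff(1)[OF int intc]
    by (intro integral_norm_bound_ennreal) (simp add: set_integrable_def)
  also have "\<dots> = (\<integral>\<^sup>+y\<in>A. ennreal (norm (f y - c)) \<partial>lebesgue)"
    by (intro nn_integral_cong) (auto split: split_indicator)
  finally show ?thesis .
qed

locale dyadic_function = dyadic_grid x0 r
  for x0 :: "real ^ 'n" and r +
  fixes f :: "real ^ 'n \<Rightarrow> 'k::{real_normed_field, euclidean_space}"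
  assumes f_meas [measurable]: "f \<in> borel_measurable lebesgue"
    and f_int: "set_integrable lebesgue (cube x0 r) f"
begin

abbreviation "Q \<equiv> cube x0 r"

text \<open>
  Integrals of \<open>\<bar>f - c\<bar>\<close> are viewed as a measure, which makes \<open>stopping_cells\<close> applicable.
\<close>

definition osc :: "'k \<Rightarrow> (real ^ 'n) measure" where
  "osc c = density lebesgue (\<lambda>y. ennreal (norm (f y - c)))"

lemma sets_osc [simp, measurable_cong]: "sets (osc c) = sets lebesgue"
  by (simp add: osc_def)

lemma emeasure_osc:
  "A \<in> sets lebesgue \<Longrightarrow> emeasure (osc c) A = (\<integral>\<^sup>+y\<in>A. ennreal (norm (f y - c)) \<partial>lebesgue)"
  unfolding osc_def by (rule emeasure_density) auto

lemma f_int_cell: "y \<in> Q \<Longrightarrow> set_integrable lebesgue (cell m y) f"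
  by (rule set_integrable_subset[OF f_int]) (auto dest: cell_subset_cube)

lemma emeasure_cell_pos: "0 < emeasure lebesgue (cell m y)"
  using r_pos by (simp add: emeasure_cell)

lemma emeasure_cell_finite: "emeasure lebesgue (cell m y) < \<infinity>"
  by (simp add: emeasure_cell)

lemma mean_le_osc:
  assumes "y \<in> Q"
  shows "ennreal (norm (mean f m y - c)) * emeasure lebesgue (cell m y) \<le> emeasure (osc c) (cell m y)"
  unfolding mean_def emeasure_osc[OF sets_cell]
  by (rule norm_avg_le[OF sets_cell emeasure_cell_pos emeasure_cell_finite f_int_cell[OF assms]])

text \<open>
  The weak type inequality for the dyadic maximal function of \<open>f - c\<close>, localized to one cell: a maximal
  cell on which the average is farther than \<open>t > 0\<close> from \<open>c\<close> has measure at most \<open>1/t\<close> times the integral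
  of \<open>\<bar>f - c\<bar>\<close> over it.
\<close>

lemma dyadic_weak_type:
  assumes "y \<in> Q"
  shows "{z \<in> cell k y. \<exists>m\<ge>k. norm (mean f m z - c) > t} \<in> sets lebesgue"
    and "ennreal t * emeasure lebesgue {z \<in> cell k y. \<exists>m\<ge>k. norm (mean f m z - c) > t}
      \<le> emeasure (osc c) (cell k y)"
proof -
  define P where "P m z \<longleftrightarrow> z \<in> cell k y \<and> m \<ge> k \<and> norm (mean f m z - c) > t" for m z
  have eq: "{z. \<exists>m. P m z} = {z \<in> cell k y. \<exists>m\<ge>k. norm (mean f m z - c) > t}"
    by (auto simp: P_def)
  have sat: "P m w" if "w \<in> cell m z" "P m z" for m z w
  proof -
    have "w \<in> cell k z"
      using that cell_antimono[of k m z] by (auto simp: P_def)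
    then have "w \<in> cell k y"
      using that cell_eq by (auto simp: P_def)
    then show ?thesis using that mean_cell[of w m z f] by (simp add: P_def)
  qed
  have le: "emeasure (scale_measure (ennreal t) lebesgue) (cell m z) \<le> emeasure (osc c) (cell m z)"
    if "P m z" for m z
  proof -
    have "z \<in> Q"
      using that cell_subset_cube[OF assms, of k] by (auto simp: P_def)
    have "ennreal t * emeasure lebesgue (cell m z) \<le>
        ennreal (norm (mean f m z - c)) * emeasure lebesgue (cell m z)"
      using that by (intro mult_right_mono ennreal_leI) (auto simp: P_def)
    also have "\<dots> \<le> emeasure (osc c) (cell m z)"
      by (rule mean_le_osc[OF \<open>z \<in> Q\<close>])
    finally show ?thesis by simp
  qed
  note st = stopping_cells[of P "scale_measure (ennreal t) lebesgue" "osc c", OF sat _ _ le]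
  show *: "{z \<in> cell k y. \<exists>m\<ge>k. norm (mean f m z - c) > t} \<in> sets lebesgue"
    unfolding eq[symmetric] by (rule st(1)) simp_all
  have "ennreal t * emeasure lebesgue {z. \<exists>m. P m z} \<le> emeasure (osc c) {z. \<exists>m. P m z}"
    using st(2) by simp
  also have "\<dots> \<le> emeasure (osc c) (cell k y)"
    by (rule emeasure_mono) (auto simp: P_def)
  finally show "ennreal t * emeasure lebesgue {z \<in> cell k y. \<exists>m\<ge>k. norm (mean f m z - c) > t}
      \<le> emeasure (osc c) (cell k y)"
    unfolding eq .
qed

lemma osc_cube_finite: "emeasure (osc c) Q < \<infinity>"
proof -
  have "set_integrable lebesgue Q (\<lambda>y. f y - c)"
    by (intro set_integral_diff(1) f_int)
      (simp add: set_integrable_def emeasure_cube[OF r_pos])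
  then have "(\<integral>\<^sup>+y. ennreal (norm (indicator Q y *\<^sub>R (f y - c))) \<partial>lebesgue) < \<infinity>"
    unfolding set_integrable_def integrable_iff_bounded by simp
  also have "(\<integral>\<^sup>+y. ennreal (norm (indicator Q y *\<^sub>R (f y - c))) \<partial>lebesgue) = emeasure (osc c) Q"
    unfolding emeasure_osc[OF sets_cube]
    by (intro nn_integral_cong) (auto split: split_indicator)
  finally show ?thesis .
qed

text \<open>
  The core of Lebesgue differentiation along dyadic cubes: \<open>f\<close> cannot be close to \<open>v\<close> on a set of
  positive measure while all averages stay twice as far from \<open>v\<close>. Cover \<open>A\<close> by cells inside a
  neighbourhood \<open>W\<close>. As the averages are far from \<open>v\<close>, \<open>2 t \<bar>A\<bar>\<close> is at most the integral of \<open>\<bar>f - v\<bar>\<close> over \<open>W\<close>; as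
  \<open>W\<close> shrinks to \<open>A\<close>, this tends to the integral over \<open>A\<close>, which is at most \<open>t \<bar>A\<bar>\<close>.
\<close>

lemma dyadic_differentiation:
  assumes A: "A \<in> sets lebesgue" "A \<subseteq> Q"
    and near: "\<And>y. y \<in> A \<Longrightarrow> norm (f y - v) \<le> t"
    and far: "\<And>y m. y \<in> A \<Longrightarrow> 2 * t \<le> norm (mean f m y - v)"
    and t: "t > 0"
  shows "A \<in> null_sets lebesgue"
proof -
  have "\<exists>T. open T \<and> A \<subseteq> T \<and> emeasure lebesgue (T - A) < ennreal ((1/2) ^ n)" for n
    by (rule sets_lebesgue_outer_open[OF A(1), of "(1/2) ^ n"]) (simp, blast)
  then obtain T where T: "\<And>n. open (T n)" "\<And>n. A \<subseteq> T n"
    "\<And>n. emeasure lebesgue (T n - A) < ennreal ((1/2) ^ n)"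
    by metis
  define W where "W n = (\<Inter>k\<le>n. T k) \<inter> Q" for n
  have openW: "open (\<Inter>k\<le>n. T k)" for n
    using T(1) by (intro open_INT) auto
  have W_sets [measurable]: "W n \<in> sets lebesgue" for n
    unfolding W_def using openW by (intro sets.Int sets_cube) (simp add: borel_open)
  have AW: "A \<subseteq> W n" for n
    using T(2) A(2) by (auto simp: W_def)
  have decW: "decseq W"
    unfolding W_def decseq_def by (auto intro: order_trans)
  have W_finite: "emeasure (osc v) (W n) < \<infinity>" for n
    by (rule le_less_trans[OF emeasure_mono osc_cube_finite]) (auto simp: W_def)
  (* stopping at cells that lie inside the neighbourhood W n *)
  have Wle: "ennreal (2 * t) * emeasure lebesgue A \<le> emeasure (osc v) (W n)" for n
  proof -
    define P where "P m z \<longleftrightarrow> z \<in> Q \<and> cell m z \<subseteq> W n \<and> 2 * t \<le> norm (mean f m z - v)" for m z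
    have sat: "P m w" if "w \<in> cell m z" "P m z" for m z w
    proof -
      have "w \<in> Q" using that by (auto simp: P_def W_def)
      then show ?thesis using that mean_cell[of w m z f] cell_eq[of w m z] by (simp add: P_def)
    qed
    have le: "emeasure (scale_measure (ennreal (2 * t)) lebesgue) (cell m z)
        \<le> emeasure (osc v) (cell m z)" if "P m z" for m z
    proof -
      have "ennreal (2 * t) * emeasure lebesgue (cell m z) \<le>
          ennreal (norm (mean f m z - v)) * emeasure lebesgue (cell m z)"
        using that by (intro mult_right_mono ennreal_leI) (auto simp: P_def)
      also have "\<dots> \<le> emeasure (osc v) (cell m z)"
        using that by (intro mean_le_osc) (simp add: P_def)
      finally show ?thesis by simp
    qed
    note st = stopping_cells[of P "scale_measure (ennreal (2 * t)) lebesgue" "osc v", OF sat _ _ le]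
    have AU: "A \<subseteq> {z. \<exists>m. P m z}"
    proof
      fix y assume y: "y \<in> A"
      then obtain m where "cell m y \<subseteq> (\<Inter>k\<le>n. T k)"
        using cell_in_open[OF openW, of y n] T(2) by auto
      moreover have "cell m y \<subseteq> Q"
        using y A(2) by (intro cell_subset_cube) auto
      ultimately show "y \<in> {z. \<exists>m. P m z}"
        using y far A(2) by (auto simp: P_def W_def)
    qed
    have "ennreal (2 * t) * emeasure lebesgue A \<le> ennreal (2 * t) * emeasure lebesgue {z. \<exists>m. P m z}"
      using st(1) by (intro mult_left_mono emeasure_mono AU) simp_all
    also have "\<dots> \<le> emeasure (osc v) {z. \<exists>m. P m z}"
      using st(2) by simp
    also have "\<dots> \<le> emeasure (osc v) (W n)"
      using self_in_cell by (intro emeasure_mono) (auto simp: P_def)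
    finally show ?thesis .
  qed
  have null: "(\<Inter>n. W n) - A \<in> null_sets lebesgue"
  proof -
    have "emeasure lebesgue ((\<Inter>n. W n) - A) \<le> ennreal ((1/2) ^ n)" for n
    proof -
      have "emeasure lebesgue ((\<Inter>n. W n) - A) \<le> emeasure lebesgue (T n - A)"
        using A(1) T(1) by (intro emeasure_mono) (auto simp: W_def borel_open)
      with T(3)[of n] show ?thesis by simp
    qed
    moreover have "(\<lambda>n. ennreal ((1/2) ^ n)) \<longlonglongrightarrow> ennreal 0"
      by (intro tendsto_ennrealI LIMSEQ_power_zero) simp
    ultimately have "emeasure lebesgue ((\<Inter>n. W n) - A) \<le> ennreal 0"
      by (intro LIMSEQ_le_const[of _ "ennreal 0"]) auto
    then show ?thesis
      using A(1) W_sets by (intro null_setsI) auto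
  qed
  have "ennreal (2 * t) * emeasure lebesgue A \<le> (INF n. emeasure (osc v) (W n))"
    by (rule INF_greatest) (rule Wle)
  also have "\<dots> = emeasure (osc v) (\<Inter>n. W n)"
    using decW W_finite by (intro INF_emeasure_decseq) (auto simp: less_top[symmetric])
  also have "\<dots> = emeasure (osc v) A"
  proof -
    have "(\<Inter>n. W n) - A \<in> null_sets (osc v)"
      using null absolutely_continuousI_density[of "\<lambda>y. ennreal (norm (f y - v))" lebesgue]
      unfolding osc_def absolutely_continuous_def by auto
    then have "emeasure (osc v) (A \<union> ((\<Inter>n. W n) - A)) = emeasure (osc v) A"
      using A(1) by (intro emeasure_Un_null_set) simp
    moreover have "A \<union> ((\<Inter>n. W n) - A) = (\<Inter>n. W n)"
      using AW by auto
    ultimately show ?thesis by simp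
  qed
  also have "\<dots> \<le> ennreal t * emeasure lebesgue A"
    unfolding emeasure_osc[OF A(1)] using A(1)
    by (subst nn_integral_cmult_indicator[symmetric])
      (auto intro!: nn_integral_mono ennreal_leI near split: split_indicator)
  finally have le: "ennreal (2 * t) * emeasure lebesgue A \<le> ennreal t * emeasure lebesgue A" .
  have "emeasure lebesgue A \<le> emeasure lebesgue Q"
    using A by (intro emeasure_mono) auto
  then have "emeasure lebesgue A < \<infinity>"
    by (simp add: emeasure_cube[OF r_pos] le_less_trans)
  then obtain a where a: "emeasure lebesgue A = ennreal a" "a \<ge> 0"
    by (metis ennreal_cases infinity_ennreal_def less_irrefl)
  with le t have "2 * t * a \<le> t * a"
    by (simp add: ennreal_mult[symmetric])
  with t a(2) have "a = 0"
    by (simp add: mult_less_0_iff)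
  with a A(1) show ?thesis
    by (intro null_setsI) auto
qed

text \<open>
  Bounds on the averages pass to \<open>f\<close> itself. Where they fail to, some point \<open>v\<close> of a countable
  dense set approximates \<open>f y\<close> so well that \<open>dyadic_differentiation\<close> applies.
\<close>

lemma AE_norm_le_of_means:
  "AE y in lebesgue. y \<in> Q \<longrightarrow> (\<forall>b. (\<forall>m. norm (mean f m y - c) \<le> b) \<longrightarrow> norm (f y - c) \<le> b)"
proof -
  obtain D :: "'k set" where D: "countable D" "\<And>U. open U \<Longrightarrow> U \<noteq> {} \<Longrightarrow> \<exists>d\<in>D. d \<in> U"
    using countable_dense_exists by blast
  define E where "E v n = {y \<in> Q. norm (f y - v) \<le> 1 / Suc n \<and> (\<forall>m. 2 / Suc n \<le> norm (mean f m y - v))}"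
    for v :: 'k and n :: nat
  have [measurable]: "mean f m \<in> borel_measurable lebesgue" for m
  proof (rule measurableI)
    fix S :: "'k set"
    show "mean f m -` S \<inter> space lebesgue \<in> sets lebesgue"
      by (rule sets_saturated[of m]) (auto simp: mean_cell)
  qed auto
  have E_sets: "E v n \<in> sets lebesgue" for v n
    unfolding E_def by measurable
  have null: "E v n \<in> null_sets lebesgue" for v n
    by (rule dyadic_differentiation[where t = "1 / Suc n" and v = v]) (auto simp: E_sets E_def)
  have "AE y in lebesgue. \<forall>v\<in>D. \<forall>n. y \<notin> E v n"
    unfolding AE_all_countable AE_ball_countable[OF D(1)]
    by (intro ballI allI AE_not_in null)
  then show ?thesis
  proof (rule AE_mp, intro AE_I2 impI allI)
    fix y b assume y: "\<forall>v\<in>D. \<forall>n. y \<notin> E v n" "y \<in> Q" and b: "\<forall>m. norm (mean f m y - c) \<le> b"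
    show "norm (f y - c) \<le> b"
    proof (rule ccontr)
      assume "\<not> norm (f y - c) \<le> b"
      (* a third of the gap leaves 2 / Suc n after approximating f y by v *)
      then obtain n where n: "1 / Suc n < (norm (f y - c) - b) / 3"
        using nat_approx_posE[of "(norm (f y - c) - b) / 3"] by auto
      define u where "u = 1 / Suc n"
      have "ball (f y) (1 / Suc n) \<noteq> {}" by simp
      then obtain v where v: "v \<in> D" "v \<in> ball (f y) (1 / Suc n)"
        using D(2)[OF open_ball] by blast
      then have v': "norm (f y - v) < 1 / Suc n" by (simp add: dist_norm)
      have "2 / Suc n \<le> norm (mean f m y - v)" for m
      proof -
        have "norm (f y - c) \<le> norm (f y - v) + (norm (mean f m y - v) + norm (mean f m y - c))"
          by norm
        also have "norm (f y - v) < u"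
          using v' by (simp only: u_def)
        also have "norm (mean f m y - c) \<le> b"
          using b ..
        also have "b \<le> norm (f y - c) - 3 * u"
          using n unfolding u_def[symmetric] by simp
        finally have "2 * u \<le> norm (mean f m y - v)"
          by simp
        then show ?thesis by (simp add: u_def)
      qed
      with v' y(2) have "y \<in> E v n"
        by (simp add: E_def less_imp_le)
      with y(1) v(1) show False by blast
    qed
  qed
qed

end

lemma enn_powr_ge:
  assumes "ennreal s \<le> x" "0 \<le> s" "0 \<le> p"
  shows "ennreal (s powr p) \<le> enn_powr x p"
proof (cases x)
  case (real t)
  then show ?thesis
    using assms by (auto simp: enn_powr_def intro!: ennreal_leI powr_mono2)
qed (simp add: enn_powr_def)

section \<open>Reference values of a function of bounded mean oscillation\<close>

locale bounded_dyadic_oscillation = dyadic_function x0 r f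
  for x0 :: "real ^ 'n" and r and f :: "real ^ 'n \<Rightarrow> 'k::{real_normed_field, euclidean_space}" +
  fixes d :: real
  assumes d_pos: "d > 0"
    and osc_le: "y \<in> Q \<Longrightarrow>
      emeasure (osc (mean f m y)) (cell m y) \<le> ennreal d * emeasure lebesgue (cell m y)"
begin

text \<open>
  The reference value at \<open>y\<close> after \<open>m\<close> generations, and the number of values it has taken so far. Recursion
  over the generation keeps both of them constant on cells and avoids handling stopping times.
\<close>

primrec ref :: "nat \<Rightarrow> real ^ 'n \<Rightarrow> 'k" where
  "ref 0 y = mean f 0 y"
| "ref (Suc m) y = (if norm (mean f (Suc m) y - ref m y) > 2 * d then mean f (Suc m) y else ref m y)"

primrec cnt :: "nat \<Rightarrow> real ^ 'n \<Rightarrow> nat" where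
  "cnt 0 y = 1"
| "cnt (Suc m) y = cnt m y + (if norm (mean f (Suc m) y - ref m y) > 2 * d then 1 else 0)"

definition level :: "nat \<Rightarrow> (real ^ 'n) set" where
  "level k = {y \<in> Q. \<exists>m. cnt m y > k}"

lemma ref_cnt_cell: "z \<in> cell m y \<Longrightarrow> ref m z = ref m y \<and> cnt m z = cnt m y"
proof (induction m)
  case (Suc m)
  then have "z \<in> cell m y" "mean f (Suc m) z = mean f (Suc m) y"
    using cell_Suc_subset mean_cell by blast+
  with Suc.IH show ?case by simp
qed (simp add: mean_cell)

lemma sets_level [measurable, simp]: "level k \<in> sets lebesgue"
proof -
  have "{y. cnt m y > k} \<in> sets lebesgue" for m
    by (rule sets_saturated[of m]) (auto simp: ref_cnt_cell)
  then have "Q \<inter> (\<Union>m. {y. cnt m y > k}) \<in> sets lebesgue"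
    by (intro sets.Int sets_cube sets.countable_UN) auto
  also have "Q \<inter> (\<Union>m. {y. cnt m y > k}) = level k"
    by (auto simp: level_def)
  finally show ?thesis .
qed

lemma level_antimono: "k \<le> l \<Longrightarrow> level l \<subseteq> level k"
  by (auto simp: level_def intro: le_less_trans)

text \<open>
  A child carries the fraction \<open>2\<^sup>-\<^sup>n\<close> of the measure of its parent, which is where \<open>2\<^sup>n\<close> comes from.
\<close>

lemma mean_jump:
  assumes "y \<in> Q"
  shows "norm (mean f (Suc m) y - mean f m y) \<le> 2 ^ CARD('n) * d"
proof -
  define s where "s = (2 * r / 2 ^ Suc m) ^ CARD('n)"
  have s: "s > 0" using r_pos by (simp add: s_def)
  have small: "emeasure lebesgue (cell (Suc m) y) = ennreal s"
    by (simp only: emeasure_cell s_def)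
  have "2 * r / 2 ^ m = 2 * (2 * r / 2 ^ Suc m)" by simp
  then have big: "emeasure lebesgue (cell m y) = ennreal (2 ^ CARD('n) * s)"
    unfolding emeasure_cell s_def by (simp only: power_mult_distrib)
  have "ennreal (norm (mean f (Suc m) y - mean f m y)) * ennreal s \<le> emeasure (osc (mean f m y)) (cell (Suc m) y)"
    using mean_le_osc[OF assms, of "Suc m" "mean f m y"] unfolding small .
  also have "\<dots> \<le> emeasure (osc (mean f m y)) (cell m y)"
    by (intro emeasure_mono cell_Suc_subset) simp
  also have "\<dots> \<le> ennreal d * ennreal (2 ^ CARD('n) * s)"
    using osc_le[OF assms, of m] unfolding big .
  finally have "norm (mean f (Suc m) y - mean f m y) * s \<le> d * (2 ^ CARD('n) * s)"
    using s d_pos by (simp add: ennreal_mult[symmetric])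
  then have "norm (mean f (Suc m) y - mean f m y) * s \<le> (2 ^ CARD('n) * d) * s"
    by (simp add: ac_simps)
  then show ?thesis
    using s by (simp only: mult_le_cancel_right_pos)
qed

lemma mean_near_ref: "norm (mean f m y - ref m y) \<le> 2 * d"
  using d_pos by (cases m) auto

lemma cnt_mono: "m \<le> m' \<Longrightarrow> cnt m y \<le> cnt m' y"
  by (induction rule: dec_induct) auto

lemma ref_near_mean:
  assumes "y \<in> Q"
  shows "norm (ref m y - avg Q f) \<le> (2 + 2 ^ CARD('n)) * d * (real (cnt m y) - 1)"
proof (induction m)
  case 0
  then show ?case
    using assms by (simp add: mean_def cell_0)
next
  case (Suc m)
  show ?case
  proof (cases "norm (mean f (Suc m) y - ref m y) > 2 * d")
    case True
    have "norm (mean f (Suc m) y - avg Q f)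
        \<le> norm (mean f (Suc m) y - mean f m y) + (norm (mean f m y - ref m y) + norm (ref m y - avg Q f))"
      by norm
    also have "\<dots> \<le> 2 ^ CARD('n) * d + (2 * d + (2 + 2 ^ CARD('n)) * d * (real (cnt m y) - 1))"
      by (intro add_mono mean_jump[OF assms] mean_near_ref Suc)
    also have "\<dots> = (2 + 2 ^ CARD('n)) * d * (real (cnt m y + 1) - 1)"
      by (simp add: algebra_simps)
    finally show ?thesis using True by simp
  qed (use Suc in simp)
qed

lemma mean_le_cnt:
  assumes "y \<in> Q"
  shows "norm (mean f m y - avg Q f) \<le> (2 + 2 ^ CARD('n)) * d * real (cnt m y)"
proof -
  have "norm (mean f m y - avg Q f) \<le> norm (mean f m y - ref m y) + norm (ref m y - avg Q f)"
    by norm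
  also have "\<dots> \<le> 2 * d + (2 + 2 ^ CARD('n)) * d * (real (cnt m y) - 1)"
    by (intro add_mono mean_near_ref ref_near_mean assms)
  also have "\<dots> \<le> (2 + 2 ^ CARD('n)) * d * real (cnt m y)"
    using d_pos by (simp add: algebra_simps)
  finally show ?thesis .
qed

text \<open>
  The counter grows in steps of one, so it passes through \<open>k + 1\<close>, and it does so at a generation
  where the reference value has just been reset to the average.
\<close>

lemma level_selected:
  assumes "y \<in> level k"
  obtains m where "cnt m y = Suc k" "ref m y = mean f m y"
proof -
  define m where "m = (LEAST m. cnt m y > k)"
  have m: "cnt m y > k"
    using assms unfolding m_def level_def by (auto intro: LeastI)
  have lt: "cnt l y \<le> k" if "l < m" for l
    using not_less_Least[of l "\<lambda>m. cnt m y > k"] that unfolding m_def by simp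
  have "cnt m y = Suc k \<and> ref m y = mean f m y"
  proof (cases m)
    case 0
    then show ?thesis using m by simp
  next
    case (Suc l)
    then show ?thesis
      using m lt[of l] by (auto split: if_splits)
  qed
  then show ?thesis using that by blast
qed

text \<open>
  Points of a selected cell \<open>R\<close> where the reference value changes again see an average farther than \<open>2 d\<close> from
  that of \<open>R\<close>. By the weak type inequality they fill at most \<open>d \<bar>R\<bar> / (2 d) = \<bar>R\<bar> / 2\<close>, which explains the
  threshold \<open>2 d\<close> in the definition of \<open>ref\<close>.
\<close>

lemma half_of_selected_cell:
  assumes "y \<in> level k" and m: "cnt m y = Suc k" "ref m y = mean f m y"
  shows "emeasure lebesgue (cell m y) \<le> 2 * emeasure lebesgue (cell m y \<inter> (level k - level (Suc k)))"
proof -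
  have y: "y \<in> Q" using assms(1) by (simp add: level_def)
  have sub: "cell m y \<subseteq> level k"
  proof
    fix z assume z: "z \<in> cell m y"
    then have "cnt m z > k" using m by (simp add: ref_cnt_cell)
    with z cell_subset_cube[OF y] show "z \<in> level k"
      by (auto simp: level_def)
  qed
  define B where "B = {z \<in> cell m y. \<exists>m'\<ge>m. norm (mean f m' z - mean f m y) > 2 * d}"
  have B_sets: "B \<in> sets lebesgue"
    unfolding B_def using y d_pos by (intro dyadic_weak_type(1)) auto
  have "ennreal (2 * d) * emeasure lebesgue B \<le> emeasure (osc (mean f m y)) (cell m y)"
    unfolding B_def using y d_pos by (intro dyadic_weak_type(2)) auto
  also have "\<dots> \<le> ennreal d * emeasure lebesgue (cell m y)"
    by (rule osc_le[OF y])
  finally have weak: "ennreal (2 * d) * emeasure lebesgue B \<le> ennreal d * emeasure lebesgue (cell m y)" .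
  have sub_B: "cell m y \<inter> level (Suc k) \<subseteq> B"
  proof (rule subsetI, rule ccontr)
    fix z assume z: "z \<in> cell m y \<inter> level (Suc k)" "z \<notin> B"
    then have near: "norm (mean f m' z - mean f m y) \<le> 2 * d" if "m' \<ge> m" for m'
      using that by (auto simp: B_def not_less)
    have stay: "ref m' z = mean f m y \<and> cnt m' z = Suc k" if "m' \<ge> m" for m'
      using that
    proof (induction rule: dec_induct)
      case base
      then show ?case using z(1) m by (auto simp: ref_cnt_cell)
    next
      case (step l)
      then show ?case using near[of "Suc l"] by simp
    qed
    have "cnt l z \<le> Suc k" for l
      using stay[of "max l m"] cnt_mono[of l "max l m" z] by simp
    with z(1) show False by (auto simp: level_def not_less[symmetric])
  qed
  define s where "s = (2 * r / 2 ^ m) ^ CARD('n)"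
  have s: "emeasure lebesgue (cell m y) = ennreal s" "s \<ge> 0"
    using r_pos by (simp_all add: emeasure_cell s_def)
  have Bs: "B \<subseteq> cell m y" by (auto simp: B_def)
  then have "emeasure lebesgue B \<le> ennreal s"
    unfolding s(1)[symmetric] by (intro emeasure_mono) auto
  then obtain b where b: "emeasure lebesgue B = ennreal b" "b \<ge> 0"
    by (metis ennreal_cases ennreal_neq_top neq_top_trans)
  have "2 * d * b \<le> d * s"
    using weak b s d_pos by (simp add: ennreal_mult[symmetric])
  then have bs: "2 * b \<le> s"
    using d_pos by simp
  have "emeasure lebesgue (cell m y - B) = ennreal (s - b)"
    using b Bs B_sets s by (subst emeasure_Diff) (auto simp: ennreal_minus)
  moreover have "emeasure lebesgue (cell m y - B)
      \<le> emeasure lebesgue (cell m y \<inter> (level k - level (Suc k)))"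
    using sub sub_B by (intro emeasure_mono) auto
  ultimately have "2 * ennreal (s - b) \<le> 2 * emeasure lebesgue (cell m y \<inter> (level k - level (Suc k)))"
    by (intro mult_left_mono) auto
  moreover have "ennreal s \<le> 2 * ennreal (s - b)"
  proof -
    have "2 * ennreal (s - b) = ennreal (2 * (s - b))"
      using bs b(2) by (subst ennreal_mult) auto
    then show ?thesis using bs by (simp add: ennreal_leI)
  qed
  ultimately show ?thesis
    unfolding s(1) by (rule order_trans[rotated])
qed

lemma maximal_layer_ge:
  assumes "y \<in> level k"
  shows "ennreal (1/2) \<le> maximal (indicator (level k - level (Suc k)) :: real ^ 'n \<Rightarrow> 'k) y"
proof -
  obtain m where m: "cnt m y = Suc k" "ref m y = mean f m y"
    using level_selected[OF assms] .
  let ?L = "level k - level (Suc k)"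
  let ?R = "cell m y"
  let ?F = "indicator ?L :: real ^ 'n \<Rightarrow> 'k"
  have cube: "?R \<in> cubes"
    using cell_is_cube[of m y] r_pos unfolding cubes_def
    by (auto intro!: exI[of _ "r / 2 ^ m"])
  have "(\<integral>\<^sup>+z\<in>?R. ennreal (norm (?F z)) \<partial>lebesgue) = (\<integral>\<^sup>+z. indicator (?R \<inter> ?L) z \<partial>lebesgue)"
    by (intro nn_integral_cong) (auto split: split_indicator)
  also have "\<dots> = emeasure lebesgue (?R \<inter> ?L)"
    by simp
  finally have int: "(\<integral>\<^sup>+z\<in>?R. ennreal (norm (?F z)) \<partial>lebesgue) = emeasure lebesgue (?R \<inter> ?L)" .
  define s where "s = (2 * r / 2 ^ m) ^ CARD('n)"
  have s: "emeasure lebesgue ?R = ennreal s" "s > 0"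
    using r_pos by (simp_all add: emeasure_cell s_def)
  have "emeasure lebesgue (?R \<inter> ?L) \<le> ennreal s"
    unfolding s(1)[symmetric] by (intro emeasure_mono) auto
  then obtain b where b: "emeasure lebesgue (?R \<inter> ?L) = ennreal b" "b \<ge> 0"
    by (metis ennreal_cases ennreal_neq_top neq_top_trans)
  have "ennreal s \<le> 2 * ennreal b"
    using half_of_selected_cell[OF assms m] unfolding s(1) b(1) .
  also have "2 * ennreal b = ennreal (2 * b)"
    using b(2) by (subst ennreal_mult) auto
  finally have "s \<le> 2 * b"
    using b(2) by simp
  then have "1/2 \<le> 1 / s * b"
    using s(2) by (simp add: field_simps)
  then have "ennreal (1/2) \<le> ennreal (1 / s * b)"
    by (rule ennreal_leI)
  also have "\<dots> = 1 / ennreal s * ennreal b"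
    using s(2) b(2) divide_ennreal[of 1 s] by (subst ennreal_mult) auto
  also have "\<dots> = indicator ?R y / emeasure lebesgue ?R * (\<integral>\<^sup>+z\<in>?R. ennreal (norm (?F z)) \<partial>lebesgue)"
    unfolding int b(1) s(1) by simp
  also have "\<dots> \<le> maximal ?F y"
    unfolding maximal_def using cube by (intro SUP_upper)
  finally show ?thesis .
qed

text \<open>
  The indicators of the disjoint sets \<open>level k - level (k + 1)\<close>, extended by zero to negative indices so as
  to form a two-sided sequence.
\<close>

definition layer :: "int \<Rightarrow> real ^ 'n \<Rightarrow> 'k" where
  "layer j = (if j \<ge> 0 then indicator (level (nat j) - level (Suc (nat j))) else (\<lambda>_. 0))"

lemma layer_L0: "layer j \<in> L0"
  unfolding layer_def L0_def by auto

lemma sum_maximal_layers_ge: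
  assumes "y \<in> Q" "0 \<le> p"
  shows "ennreal (real (cnt m y) * (1/2) powr p) \<le> (\<Sum>\<^sub>\<infinity>j. enn_powr (maximal (layer j) y) p)"
proof -
  have ge: "ennreal ((1/2) powr p) \<le> enn_powr (maximal (layer (int k)) y) p" if "k < cnt m y" for k
  proof (rule enn_powr_ge)
    have "y \<in> level k"
      using assms(1) that by (auto simp: level_def)
    then show "ennreal (1/2) \<le> maximal (layer (int k)) y"
      using maximal_layer_ge by (simp add: layer_def)
  qed (use assms in auto)
  have "ennreal (real (cnt m y) * (1/2) powr p) = (\<Sum>k<cnt m y. ennreal ((1/2) powr p))"
    by (simp add: ennreal_mult ennreal_of_nat_eq_real_of_nat)
  also have "\<dots> \<le> (\<Sum>k<cnt m y. enn_powr (maximal (layer (int k)) y) p)"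
    by (intro sum_mono ge) simp
  also have "\<dots> = (\<Sum>j\<in>int ` {..<cnt m y}. enn_powr (maximal (layer j) y) p)"
    by (subst sum.reindex) auto
  also have "\<dots> \<le> (\<Sum>\<^sub>\<infinity>j. enn_powr (maximal (layer j) y) p)"
    by (subst nonneg_infsum_complete) (auto intro!: SUP_upper)
  finally show ?thesis .
qed

lemma sum_layers:
  "(\<Sum>\<^sub>\<infinity>j. ennreal (norm (layer j y) powr p)) = indicator (\<Union>k. level k - level (Suc k)) y"
proof (cases "\<exists>k. y \<in> level k - level (Suc k)")
  case True
  then obtain k where k: "y \<in> level k - level (Suc k)" ..
  have "layer j y = 0" if "j \<noteq> int k" for j
  proof -
    have "y \<notin> level l - level (Suc l)" if "l \<noteq> k" for l
      using k level_antimono[of "Suc l" k] level_antimono[of "Suc k" l] that by (cases "l < k") auto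
    from this[of "nat j"] that show ?thesis
      by (auto simp: layer_def)
  qed
  then have "(\<Sum>\<^sub>\<infinity>j. ennreal (norm (layer j y) powr p))
      = (\<Sum>\<^sub>\<infinity>j\<in>{int k}. ennreal (norm (layer j y) powr p))"
    by (intro infsum_cong_neutral) auto
  also have "\<dots> = 1"
    using k by (simp add: layer_def)
  finally show ?thesis using True by auto
next
  case False
  then have "layer j y = 0" for j
    by (auto simp: layer_def)
  then show ?thesis using False by auto
qed

lemma AE_norm_le_sum_maximal_layers:
  assumes "0 \<le> p"
  shows "AE y in lebesgue. y \<in> Q \<longrightarrow> (\<Sum>\<^sub>\<infinity>j. enn_powr (maximal (layer j) y) p) < \<infinity> \<longrightarrow>
    norm (f y - avg Q f)
      \<le> (2 + 2 ^ CARD('n)) * d * 2 powr p * enn2real (\<Sum>\<^sub>\<infinity>j. enn_powr (maximal (layer j) y) p)"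
  using AE_norm_le_of_means[of "avg Q f"]
proof (rule AE_mp, intro AE_I2 impI)
  fix y
  let ?S = "\<Sum>\<^sub>\<infinity>j. enn_powr (maximal (layer j) y) p"
  assume *: "y \<in> Q \<longrightarrow> (\<forall>b. (\<forall>m. norm (mean f m y - avg Q f) \<le> b) \<longrightarrow> norm (f y - avg Q f) \<le> b)"
    and y: "y \<in> Q" and fin: "?S < \<infinity>"
  have "norm (mean f m y - avg Q f) \<le> (2 + 2 ^ CARD('n)) * d * 2 powr p * enn2real ?S" for m
  proof -
    have "ennreal (real (cnt m y) * (1/2) powr p) \<le> ennreal (enn2real ?S)"
      using sum_maximal_layers_ge[OF y assms, of m] fin by simp
    then have "real (cnt m y) * (1/2) powr p \<le> enn2real ?S"
      by simp
    then have "2 powr p * (real (cnt m y) * (1/2) powr p) \<le> 2 powr p * enn2real ?S"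
      by (intro mult_left_mono) auto
    also have "2 powr p * (real (cnt m y) * (1/2) powr p) = real (cnt m y)"
      by (simp add: powr_divide)
    finally have "(2 + 2 ^ CARD('n)) * d * real (cnt m y) \<le> (2 + 2 ^ CARD('n)) * d * (2 powr p * enn2real ?S)"
      using d_pos by (intro mult_left_mono) auto
    with mean_le_cnt[OF y, of m] show ?thesis
      by (simp only: mult.assoc)
  qed
  with * y show "norm (f y - avg Q f) \<le> (2 + 2 ^ CARD('n)) * d * 2 powr p * enn2real ?S"
    by blast
qed

end

section \<open>Locally integrable functions and the weight\<close>

lemma L1_loc_measurable:
  fixes f :: "real ^ 'n \<Rightarrow> 'k::{real_normed_field, euclidean_space}"
  assumes "f \<in> L1_loc"
  shows "f \<in> borel_measurable lebesgue"
proof (rule borel_measurable_LIMSEQ_metric)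
  fix n :: nat
  have "set_integrable lebesgue (cball 0 (real n)) f"
    using assms by (simp add: L1_loc_def)
  then show "(\<lambda>x. indicator (cball 0 (real n)) x *\<^sub>R f x) \<in> borel_measurable lebesgue"
    unfolding set_integrable_def by (rule borel_measurable_integrable)
next
  fix x :: "real ^ 'n"
  obtain k :: nat where k: "norm x \<le> real k"
    using real_arch_simple by blast
  have "\<forall>\<^sub>F n in sequentially. indicator (cball 0 (real n)) x *\<^sub>R f x = f x"
    using eventually_ge_at_top[of k] by (rule eventually_mono) (use k in auto)
  then show "(\<lambda>n. indicator (cball 0 (real n)) x *\<^sub>R f x) \<longlonglongrightarrow> f x"
    by (rule tendsto_eventually)
qed

lemma L1_loc_cube:
  fixes f :: "real ^ 'n \<Rightarrow> 'k::{real_normed_field, euclidean_space}"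
  assumes "f \<in> L1_loc"
  shows "set_integrable lebesgue (cube x r) f"
proof (rule set_integrable_subset)
  let ?B = "cbox (\<chi> i. x $ i - r) (\<chi> i. x $ i + r)"
  show "set_integrable lebesgue ?B f"
    using assms by (simp add: L1_loc_def)
  show "cube x r \<subseteq> ?B"
    by (auto simp: cube_def mem_box_cart less_imp_le)
qed simp

text \<open>
  The Euclidean distance of the two centres can be as large as \<open>\<surd>n r\<close>, beyond the range \<open>r\<close> of \<open>near\<close>. Hence
  the segment between them is divided into \<open>n\<close> steps; this costs the power of \<open>B\<close>.
\<close>

lemma almost_decreasing_on_subcubes:
  fixes \<phi> :: "real ^ 'n \<Rightarrow> real \<Rightarrow> real"
  assumes decr: "\<And>x r s. 0 < s \<Longrightarrow> s \<le> r \<Longrightarrow> \<phi> x r \<le> A * \<phi> x s"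
    and near: "\<And>x y r. r > 0 \<Longrightarrow> norm (x - y) \<le> r \<Longrightarrow> \<phi> x r \<le> B * \<phi> y r"
    and B: "B \<ge> 1"
    and c: "c \<in> cube x r" and s: "0 < s" "s \<le> r"
  shows "\<phi> x r \<le> B ^ CARD('n) * A * \<phi> c s"
proof -
  define n where "n = real CARD('n)"
  have n: "n > 0" by (simp add: n_def)
  have "r > 0" using s by simp
  have "\<bar>(c - x) $ i\<bar> \<le> r" for i
  proof -
    have "x $ i - r \<le> c $ i \<and> c $ i < x $ i + r"
      using c by (simp add: cube_def)
    then show ?thesis
      unfolding vector_minus_component by linarith
  qed
  then have "(\<Sum>i\<in>UNIV. \<bar>(c - x) $ i\<bar>) \<le> (\<Sum>i\<in>(UNIV :: 'n set). r)"
    by (intro sum_mono)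
  then have dist: "norm (c - x) \<le> n * r"
    using norm_le_l1_cart[of "c - x"] by (simp add: n_def)
  define p where "p k = x + (real k / n) *\<^sub>R (c - x)" for k :: nat
  have "\<phi> x r \<le> B ^ k * \<phi> (p k) r" for k
  proof (induction k)
    case 0
    then show ?case by (simp add: p_def)
  next
    case (Suc k)
    have "p k - p (Suc k) = (real k / n - real (Suc k) / n) *\<^sub>R (c - x)"
      unfolding p_def by (simp only: add_diff_cancel_left scaleR_left_diff_distrib)
    also have "real k / n - real (Suc k) / n = - (1 / n)"
      by (simp add: diff_divide_distrib[symmetric])
    finally have "norm (p k - p (Suc k)) = norm (c - x) / n"
      using n by simp
    also have "\<dots> \<le> r"
      using dist n by (simp add: field_simps)
    finally have "\<phi> (p k) r \<le> B * \<phi> (p (Suc k)) r"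
      by (rule near[OF \<open>r > 0\<close>])
    then have "B ^ k * \<phi> (p k) r \<le> B ^ k * (B * \<phi> (p (Suc k)) r)"
      using B by (intro mult_left_mono) auto
    with Suc show ?case by (simp add: ac_simps)
  qed
  from this[of "CARD('n)"] have "\<phi> x r \<le> B ^ CARD('n) * \<phi> c r"
    by (simp add: p_def n_def)
  also have "\<dots> \<le> B ^ CARD('n) * (A * \<phi> c s)"
    using B by (intro mult_left_mono decr s) auto
  finally show ?thesis by (simp add: mult.assoc)
qed

section \<open>Comparison of the two Campanato norms\<close>

context quasi_sBfs
begin

lemma indicator_norm_pos:
  assumes "r > 0"
  shows "N (indicator (cube x r)) > 0"
proof -
  have mem: "indicator (cube x r) \<in> X"
    using assms by (intro indicator_mem) (auto simp: cubes_def)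
  have "\<not> (AE y in lebesgue. indicator (cube x r) y = (0::'b))"
  proof
    assume "AE y in lebesgue. indicator (cube x r) y = (0::'b)"
    then have "AE y in lebesgue. y \<notin> cube x r"
      by eventually_elim (auto simp: indicator_def split: if_splits)
    then have "cube x r \<in> null_sets lebesgue"
      by (simp add: AE_iff_null_sets)
    then show False
      using emeasure_cube[OF assms, of x] assms by (auto simp: null_sets_def)
  qed
  with norm_eq_zero[OF mem] norm_nonneg[OF mem] show ?thesis
    by linarith
qed

lemma assoc_norm_duality:
  assumes h: "h \<in> X" and [measurable]: "A \<in> sets lebesgue"
  shows "(\<integral>\<^sup>+y\<in>A. ennreal (norm (h y)) \<partial>lebesgue) \<le> ennreal (N h) * assoc_norm X N (indicator A)"
proof (cases "N h = 0")
  case True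
  then have "AE y in lebesgue. h y = 0"
    using norm_eq_zero[OF h] by simp
  then have "AE y in lebesgue. ennreal (norm (h y)) * indicator A y = 0"
    by eventually_elim simp
  then show ?thesis
    by (subst nn_integral_cong_AE) auto
next
  case False
  with norm_nonneg[OF h] have Nh: "N h > 0" by simp
  (* the associate norm is tested with h scaled to norm one *)
  define g where "g = (\<lambda>y. of_real (1 / N h) * h y)"
  have g: "g \<in> X" "N g \<le> 1"
    unfolding g_def norm_scale[OF h] by (rule scale_mem[OF h]) (use Nh in \<open>simp add: norm_divide\<close>)
  have [measurable]: "h \<in> borel_measurable lebesgue"
    using h subset_L0 by (auto simp: L0_def)
  have "ennreal (1 / N h) * (\<integral>\<^sup>+y\<in>A. ennreal (norm (h y)) \<partial>lebesgue)
      = (\<integral>\<^sup>+y. ennreal (1 / N h) * (ennreal (norm (h y)) * indicator A y) \<partial>lebesgue)"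
    by (intro nn_integral_cmult[symmetric]) measurable
  also have "\<dots> = (\<integral>\<^sup>+y. ennreal (norm (indicator A y * g y)) \<partial>lebesgue)"
    using Nh by (intro nn_integral_cong)
      (auto simp: g_def norm_mult norm_divide ennreal_mult[symmetric] split: split_indicator)
  also have "\<dots> \<le> assoc_norm X N (indicator A)"
    unfolding assoc_norm_def using g by (intro SUP_upper) auto
  finally have "ennreal (N h) * (ennreal (1 / N h) * (\<integral>\<^sup>+y\<in>A. ennreal (norm (h y)) \<partial>lebesgue))
      \<le> ennreal (N h) * assoc_norm X N (indicator A)"
    by (intro mult_left_mono) auto
  then show ?thesis
    using Nh by (simp add: mult.assoc[symmetric] ennreal_mult[symmetric])
qed

lemma campanato_le_X_campanato:
  fixes \<phi> :: "real ^ 'a \<Rightarrow> real \<Rightarrow> real"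
  assumes pos: "\<And>x r. r > 0 \<Longrightarrow> \<phi> x r > 0"
    and C: "C > 0" "\<And>Q. Q \<in> cubes \<Longrightarrow>
      xnorm X N (indicator Q) * assoc_norm X N (indicator Q) \<le> ennreal C * emeasure lebesgue Q"
  shows "campanato_norm \<phi> f \<le> ennreal C * X_campanato_norm X N \<phi> f"
  unfolding campanato_norm_def
proof (rule SUP_least, clarify)
  fix x :: "real ^ 'a" and r :: real assume "r > 0"
  let ?Q = "cube x r"
  let ?h = "\<lambda>y. (f y - avg ?Q f) * indicator ?Q y"
  let ?I = "\<integral>\<^sup>+y\<in>?Q. ennreal (norm (f y - avg ?Q f)) \<partial>lebesgue"
  have Q: "?Q \<in> cubes" using \<open>r > 0\<close> by (auto simp: cubes_def)
  have mem: "indicator ?Q \<in> X" by (rule indicator_mem[OF Q])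
  define a where "a = N (indicator ?Q)"
  have a: "a > 0" "xnorm X N (indicator ?Q) = ennreal a"
    using indicator_norm_pos[OF \<open>r > 0\<close>] mem by (auto simp: a_def xnorm_def)
  define q where "q = (2 * r) ^ CARD('a)"
  have q: "q > 0" "emeasure lebesgue ?Q = ennreal q"
    unfolding q_def emeasure_cube[OF \<open>r > 0\<close>] using \<open>r > 0\<close> by simp_all
  have "ennreal (\<phi> x r) * (1 / emeasure lebesgue ?Q) * ?I
      \<le> ennreal C * (ennreal (\<phi> x r) * (xnorm X N ?h / xnorm X N (indicator ?Q)))"
  proof (cases "?h \<in> X")
    case False
    then have "ennreal C * (ennreal (\<phi> x r) * (xnorm X N ?h / xnorm X N (indicator ?Q))) = \<infinity>"
      using C(1) pos[OF \<open>r > 0\<close>, of x] a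
      by (simp add: xnorm_def ennreal_mult_top ennreal_top_divide)
    then show ?thesis by simp
  next
    case True
    have "ennreal a * assoc_norm X N (indicator ?Q) \<le> ennreal (C * q)"
      using C(2)[OF Q] C(1) q a by (simp add: ennreal_mult)
    then have "ennreal (1 / a) * (ennreal a * assoc_norm X N (indicator ?Q)) \<le> ennreal (1 / a) * ennreal (C * q)"
      by (intro mult_left_mono) auto
    then have assoc: "assoc_norm X N (indicator ?Q) \<le> ennreal (C * q / a)"
      using a(1) C(1) q(1) by (simp add: mult.assoc[symmetric] ennreal_mult[symmetric])
    have "?I = (\<integral>\<^sup>+y\<in>?Q. ennreal (norm (?h y)) \<partial>lebesgue)"
      by (intro nn_integral_cong) (auto split: split_indicator)
    also have "\<dots> \<le> ennreal (N ?h) * assoc_norm X N (indicator ?Q)"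
      by (rule assoc_norm_duality[OF True]) simp
    also have "\<dots> \<le> ennreal (N ?h) * ennreal (C * q / a)"
      by (intro mult_left_mono assoc) simp
    finally have "ennreal (\<phi> x r) * (1 / ennreal q) * ?I
        \<le> ennreal (\<phi> x r) * (1 / ennreal q) * (ennreal (N ?h) * ennreal (C * q / a))"
      by (intro mult_left_mono) auto
    also have "\<dots> = ennreal (C * (\<phi> x r * (N ?h / a)))"
      using pos[OF \<open>r > 0\<close>, of x] q(1) a(1) C(1) norm_nonneg[OF True] divide_ennreal[of 1 q]
      by (simp add: ennreal_mult[symmetric] field_simps)
    also have "\<dots> = ennreal C * (ennreal (\<phi> x r) * (ennreal (N ?h) / ennreal a))"
      using pos[OF \<open>r > 0\<close>, of x] a(1) C(1) norm_nonneg[OF True]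
      by (simp add: ennreal_mult[symmetric] divide_ennreal)
    finally show ?thesis
      using True unfolding q(2) a(2) by (simp add: xnorm_def)
  qed
  also have "\<dots> \<le> ennreal C * X_campanato_norm X N \<phi> f"
    unfolding X_campanato_norm_def using \<open>r > 0\<close>
    by (intro mult_left_mono SUP_upper2[of "(x, r)"]) auto
  finally show "ennreal (\<phi> x r) * (1 / emeasure lebesgue ?Q) * ?I \<le> ennreal C * X_campanato_norm X N \<phi> f" .
qed

text \<open>
  The maximal inequality is applied to the layers belonging to one cube. It makes the sum of the powers
  of their maximal functions finite almost everywhere and an element of \<open>X\<close> of norm at most \<open>C \<parallel>\<chi>\<^sub>Q\<parallel>\<^sub>X\<close>;
  this sum dominates the oscillation pointwise, and the ideal property finishes the argument. An upper
  bound \<open>t > 0\<close> of the Campanato norm is used instead of the norm, since the threshold \<open>2 d\<close> must be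
  positive even if the norm vanishes.
\<close>

lemma X_oscillation_le:
  fixes \<phi> :: "real ^ 'a \<Rightarrow> real \<Rightarrow> real"
  assumes pos: "\<And>x r. r > 0 \<Longrightarrow> \<phi> x r > 0"
    and K: "K > 0"
      "\<And>x r c s. c \<in> cube x r \<Longrightarrow> 0 < s \<Longrightarrow> s \<le> r \<Longrightarrow> \<phi> x r \<le> K * \<phi> c s"
    and p: "p \<ge> 0" and C: "C > 0"
    and vec: "\<And>F :: int \<Rightarrow> real ^ 'a \<Rightarrow> 'b. (\<And>j. F j \<in> L0) \<Longrightarrow>
      xnorm_enn X N (\<lambda>x. \<Sum>\<^sub>\<infinity>j. enn_powr (maximal (F j) x) p)
        \<le> ennreal C * xnorm_enn X N (\<lambda>x. \<Sum>\<^sub>\<infinity>j. ennreal (norm (F j x) powr p))"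
    and f: "f \<in> L1_loc" and t: "t > 0" "campanato_norm \<phi> f \<le> ennreal t"
    and r: "r > 0"
  shows "ennreal (\<phi> x r) * (xnorm X N (\<lambda>y. (f y - avg (cube x r) f) * indicator (cube x r) y)
           / xnorm X N (indicator (cube x r)))
    \<le> ennreal ((2 + 2 ^ CARD('a)) * 2 powr p * K * C * t)"
proof -
  interpret dyadic_function x r f
    by unfold_locales (use r f in \<open>auto intro: L1_loc_measurable L1_loc_cube\<close>)
  define d where "d = K * t / \<phi> x r"
  interpret bounded_dyadic_oscillation x r f d
  proof
    show "d > 0"
      using K(1) t(1) pos[OF r] by (simp add: d_def)
    fix y m assume y: "y \<in> cube x r"
    define s where "s = r / 2 ^ m"
    have s: "0 < s" "s \<le> r"
      using r by (simp_all add: s_def field_simps)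
    obtain c where c: "cell m y = cube c s"
      using cell_is_cube unfolding s_def by blast
    define q where "q = (2 * s) ^ CARD('a)"
    have q: "q > 0" "emeasure lebesgue (cube c s) = ennreal q"
      unfolding q_def emeasure_cube[OF s(1)] using s(1) by simp_all
    define I where "I = (\<integral>\<^sup>+z\<in>cube c s. ennreal (norm (f z - avg (cube c s) f)) \<partial>lebesgue)"
    have "c \<in> cube c s"
      using s by (simp add: cube_def)
    then have "c \<in> cube x r"
      using cell_subset_cube[OF y, of m] c by auto
    then have \<phi>: "\<phi> x r \<le> K * \<phi> c s"
      by (rule K(2)[OF _ s])
    have "ennreal (\<phi> c s) * (1 / ennreal q) * I \<le> campanato_norm \<phi> f"
      unfolding campanato_norm_def I_def q(2)[symmetric] using s
      by (intro SUP_upper2[of "(c, s)"]) auto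
    also note t(2)
    finally have "ennreal (q / \<phi> c s) * (ennreal (\<phi> c s) * (1 / ennreal q) * I)
        \<le> ennreal (q / \<phi> c s) * ennreal t"
      by (intro mult_left_mono) auto
    moreover have "ennreal (q / \<phi> c s) * (ennreal (\<phi> c s) * (1 / ennreal q) * I) = I"
      using q(1) pos[OF s(1), of c] divide_ennreal[of 1 q]
      by (simp add: mult.assoc[symmetric] ennreal_mult[symmetric])
    ultimately have "I \<le> ennreal (q * (t / \<phi> c s))"
      using q(1) pos[OF s(1), of c] t(1) by (simp add: ennreal_mult[symmetric])
    also have "\<dots> \<le> ennreal (d * q)"
    proof (rule ennreal_leI)
      have "t / \<phi> c s \<le> d"
        using \<phi> pos[OF s(1), of c] pos[OF r, of x] t(1) by (simp add: d_def field_simps)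
      then show "q * (t / \<phi> c s) \<le> d * q"
        using q(1) by (subst mult.commute) (intro mult_right_mono, simp_all)
    qed
    finally show "emeasure (osc (mean f m y)) (cell m y) \<le> ennreal d * emeasure lebesgue (cell m y)"
      using \<open>d > 0\<close> q(1) unfolding mean_def c emeasure_osc[OF sets_cube] q(2) I_def
      by (simp add: ennreal_mult)
  qed
  let ?h = "\<lambda>y. (f y - avg Q f) * indicator Q y"
  let ?S = "\<lambda>y. \<Sum>\<^sub>\<infinity>j. enn_powr (maximal (layer j) y) p"
  let ?U = "\<Union>k. level k - level (Suc k)"
  let ?G = "\<lambda>y. of_real (enn2real (?S y)) :: 'b"
  define a where "a = N (indicator Q)"
  have mem: "indicator Q \<in> X"
    using r by (intro indicator_mem) (auto simp: cubes_def)
  have a: "a > 0" "xnorm X N (indicator Q) = ennreal a"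
    using indicator_norm_pos[OF r] mem by (auto simp: a_def xnorm_def)
  have U_meas: "(indicator ?U :: real ^ 'a \<Rightarrow> 'b) \<in> L0"
    unfolding L0_def by (intro borel_measurable_indicator sets.countable_UN) auto
  have "indicator ?U \<in> X \<and> N (indicator ?U) \<le> a"
    unfolding a_def by (rule ideal[OF mem U_meas]) (auto simp: level_def indicator_def)
  moreover have "(\<lambda>y. of_real (enn2real (indicator ?U y)) :: 'b) = indicator ?U"
    by (auto simp: fun_eq_iff indicator_def)
  ultimately have "xnorm_enn X N (indicator ?U) \<le> ennreal a"
    by (auto simp: xnorm_enn_def xnorm_def intro!: ennreal_leI split: split_indicator)
  then have "ennreal C * xnorm_enn X N (indicator ?U) \<le> ennreal C * ennreal a"
    by (intro mult_left_mono) auto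
  moreover have "xnorm_enn X N ?S \<le> ennreal C * xnorm_enn X N (indicator ?U)"
    using vec[of layer, OF layer_L0] unfolding sum_layers .
  ultimately have S_le: "xnorm_enn X N ?S \<le> ennreal (C * a)"
    using C a(1) by (simp add: ennreal_mult)
  then have S_fin: "AE y in lebesgue. ?S y < \<infinity>"
    by (auto simp: xnorm_enn_def top_unique split: if_splits)
  with S_le have "xnorm X N ?G \<le> ennreal (C * a)"
    by (simp add: xnorm_enn_def)
  then have G: "?G \<in> X" "N ?G \<le> C * a"
    using C a(1) by (auto simp: xnorm_def top_unique split: if_splits)
  define b where "b = (2 + 2 ^ CARD('a)) * d * 2 powr p"
  have "b > 0" using d_pos by (simp add: b_def add_pos_pos)
  have h_meas: "?h \<in> L0"
    unfolding L0_def by measurable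
  have "AE y in lebesgue. norm (?h y) \<le> norm (of_real b * ?G y)"
    using AE_norm_le_sum_maximal_layers[OF p] S_fin
  proof eventually_elim
    case (elim y)
    then show ?case
      using \<open>b > 0\<close> by (auto simp: norm_mult b_def[symmetric] split: split_indicator)
  qed
  from ideal[OF scale_mem[OF G(1)] h_meas this]
  have h: "?h \<in> X" "N ?h \<le> N (\<lambda>y. of_real b * ?G y)" by auto
  have "N ?h \<le> b * N ?G"
    using h(2) \<open>b > 0\<close> unfolding norm_scale[OF G(1)] by simp
  also have "\<dots> \<le> b * (C * a)"
    using \<open>b > 0\<close> by (intro mult_left_mono G) auto
  finally have Nh: "N ?h \<le> b * (C * a)" .
  have "ennreal (\<phi> x r) * (xnorm X N ?h / xnorm X N (indicator Q)) = ennreal (\<phi> x r * (N ?h / a))"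
    using h(1) a pos[OF r, of x] norm_nonneg[OF h(1)]
    by (simp add: xnorm_def ennreal_mult[symmetric] divide_ennreal)
  also have "\<dots> \<le> ennreal ((2 + 2 ^ CARD('a)) * 2 powr p * K * C * t)"
  proof (rule ennreal_leI)
    have "N ?h / a \<le> b * C"
      using Nh a(1) by (simp add: field_simps)
    then have "\<phi> x r * (N ?h / a) \<le> \<phi> x r * (b * C)"
      using pos[OF r, of x] by (intro mult_left_mono) auto
    also have "\<dots> = (2 + 2 ^ CARD('a)) * 2 powr p * K * C * t"
      using pos[OF r, of x] by (simp add: b_def d_def)
    finally show "\<phi> x r * (N ?h / a) \<le> (2 + 2 ^ CARD('a)) * 2 powr p * K * C * t" .
  qed
  finally show ?thesis .
qed

text \<open>The bounds \<open>t\<close> of the preceding lemma are let decrease to the Campanato norm.\<close>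

lemma X_campanato_le_campanato:
  fixes \<phi> :: "real ^ 'a \<Rightarrow> real \<Rightarrow> real"
  assumes pos: "\<And>x r. r > 0 \<Longrightarrow> \<phi> x r > 0"
    and K: "K > 0"
      "\<And>x r c s. c \<in> cube x r \<Longrightarrow> 0 < s \<Longrightarrow> s \<le> r \<Longrightarrow> \<phi> x r \<le> K * \<phi> c s"
    and p: "p \<ge> 0" and C: "C > 0"
    and vec: "\<And>F :: int \<Rightarrow> real ^ 'a \<Rightarrow> 'b. (\<And>j. F j \<in> L0) \<Longrightarrow>
      xnorm_enn X N (\<lambda>x. \<Sum>\<^sub>\<infinity>j. enn_powr (maximal (F j) x) p)
        \<le> ennreal C * xnorm_enn X N (\<lambda>x. \<Sum>\<^sub>\<infinity>j. ennreal (norm (F j x) powr p))"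
    and f: "f \<in> L1_loc"
  shows "X_campanato_norm X N \<phi> f
    \<le> ennreal ((2 + 2 ^ CARD('a)) * 2 powr p * K * C) * campanato_norm \<phi> f"
proof -
  define L where "L = (2 + 2 ^ CARD('a)) * 2 powr p * K * C"
  have L: "L > 0" using K(1) C by (simp add: L_def add_pos_pos)
  have bound: "X_campanato_norm X N \<phi> f \<le> ennreal (L * t)"
    if "t > 0" "campanato_norm \<phi> f \<le> ennreal t" for t
    unfolding X_campanato_norm_def L_def
    by (rule SUP_least) (auto intro!: X_oscillation_le[OF pos K p C vec f that])
  have "X_campanato_norm X N \<phi> f \<le> ennreal L * campanato_norm \<phi> f"
  proof (cases "campanato_norm \<phi> f")
    case top
    then show ?thesis using L by (simp add: ennreal_mult_top)
  next
    case (real D)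
    have "X_campanato_norm X N \<phi> f \<le> ennreal L * campanato_norm \<phi> f + ennreal e" if "e > 0" for e
    proof -
      have "X_campanato_norm X N \<phi> f \<le> ennreal (L * (D + e / L))"
        using real that L by (intro bound ennreal_leI) (auto intro: add_nonneg_pos)
      also have "L * (D + e / L) = L * D + e"
        using L by (simp add: field_simps)
      finally show ?thesis
        using real L that by (simp add: ennreal_mult)
    qed
    then show ?thesis
      by (rule ennreal_le_epsilon)
  qed
  then show ?thesis by (simp only: L_def)
qed

end

theorem theorem1p5:
  fixes X :: "(real ^ 'n \<Rightarrow> 'k::{real_normed_field, euclidean_space}) set"
    and N :: "(real ^ 'n \<Rightarrow> 'k) \<Rightarrow> real"
    and \<phi> :: "real ^ 'n \<Rightarrow> real \<Rightarrow> real"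
  assumes "quasi_sBfs X N"
    and "\<And>x r. r > 0 \<Longrightarrow> \<phi> x r > 0"
    and "\<exists>C>0. \<forall>x r s. 0 < s \<and> s \<le> r \<longrightarrow> \<phi> x r \<le> C * \<phi> x s"
    and "\<exists>C\<ge>1. \<forall>x y r. r > 0 \<and> norm (x - y) \<le> r \<longrightarrow>
           1 / C \<le> \<phi> x r / \<phi> y r \<and> \<phi> x r / \<phi> y r \<le> C"
  shows
    "((\<exists>C::real. C > 0 \<and> (\<forall>Q\<in>cubes.
          xnorm X N (indicator Q) * assoc_norm X N (indicator Q)
            \<le> ennreal C * emeasure lebesgue Q)) \<longrightarrow>
      (\<exists>C::real. C > 0 \<and> (\<forall>f::real ^ 'n \<Rightarrow> 'k. f \<in> L1_loc \<longrightarrow>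
          campanato_norm \<phi> f \<le> ennreal C * X_campanato_norm X N \<phi> f)))
     \<and>
     ((\<exists>\<eta> C::real. \<eta> > 1 \<and> C > 0 \<and> (\<forall>F::int \<Rightarrow> real ^ 'n \<Rightarrow> 'k. (\<forall>j. F j \<in> L0) \<longrightarrow>
          xnorm_enn X N (\<lambda>x. \<Sum>\<^sub>\<infinity>j. enn_powr (maximal (F j) x) \<eta>)
            \<le> ennreal C * xnorm_enn X N (\<lambda>x. \<Sum>\<^sub>\<infinity>j. ennreal (norm (F j x) powr \<eta>)))) \<longrightarrow>
      (\<exists>C::real. C > 0 \<and> (\<forall>f::real ^ 'n \<Rightarrow> 'k. f \<in> L1_loc \<longrightarrow>
          X_campanato_norm X N \<phi> f \<le> ennreal C * campanato_norm \<phi> f)))"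
proof -
  interpret quasi_sBfs X N by fact
  note pos = assms(2)
  obtain A where A: "A > 0" "\<And>x r s. 0 < s \<Longrightarrow> s \<le> r \<Longrightarrow> \<phi> x r \<le> A * \<phi> x s"
    using assms(3) by blast
  obtain B where B: "B \<ge> 1"
    "\<And>x y r. r > 0 \<Longrightarrow> norm (x - y) \<le> r \<Longrightarrow> \<phi> x r / \<phi> y r \<le> B"
    using assms(4) by blast
  have near: "\<phi> x r \<le> B * \<phi> y r" if "r > 0" "norm (x - y) \<le> r" for x y r
    using B(2)[OF that] pos[OF that(1), of y] by (simp add: field_simps)
  define K where "K = B ^ CARD('n) * A"
  have K: "K > 0" "\<And>x r c s. c \<in> cube x r \<Longrightarrow> 0 < s \<Longrightarrow> s \<le> r \<Longrightarrow> \<phi> x r \<le> K * \<phi> c s"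
    using A(1) B(1) almost_decreasing_on_subcubes[of \<phi> A B, OF A(2) near B(1)]
    by (auto simp: K_def)
  show ?thesis
  proof (intro conjI impI)
    assume "\<exists>C::real. C > 0 \<and> (\<forall>Q\<in>cubes.
      xnorm X N (indicator Q) * assoc_norm X N (indicator Q) \<le> ennreal C * emeasure lebesgue Q)"
    then show "\<exists>C::real. C > 0 \<and> (\<forall>f::real ^ 'n \<Rightarrow> 'k. f \<in> L1_loc \<longrightarrow>
      campanato_norm \<phi> f \<le> ennreal C * X_campanato_norm X N \<phi> f)"
      using campanato_le_X_campanato[of \<phi>, OF pos] by blast
  next
    assume "\<exists>\<eta> C::real. \<eta> > 1 \<and> C > 0 \<and> (\<forall>F::int \<Rightarrow> real ^ 'n \<Rightarrow> 'k. (\<forall>j. F j \<in> L0) \<longrightarrow>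
      xnorm_enn X N (\<lambda>x. \<Sum>\<^sub>\<infinity>j. enn_powr (maximal (F j) x) \<eta>)
        \<le> ennreal C * xnorm_enn X N (\<lambda>x. \<Sum>\<^sub>\<infinity>j. ennreal (norm (F j x) powr \<eta>)))"
    then obtain \<eta> C where \<eta>: "\<eta> > 1" "C > 0" and
      vec: "\<And>F::int \<Rightarrow> real ^ 'n \<Rightarrow> 'k. (\<And>j. F j \<in> L0) \<Longrightarrow>
        xnorm_enn X N (\<lambda>x. \<Sum>\<^sub>\<infinity>j. enn_powr (maximal (F j) x) \<eta>)
          \<le> ennreal C * xnorm_enn X N (\<lambda>x. \<Sum>\<^sub>\<infinity>j. ennreal (norm (F j x) powr \<eta>))"
      by blast
    have "(2 + 2 ^ CARD('n)) * 2 powr \<eta> * K * C > 0"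
      using K(1) \<eta>(2) by (simp add: add_pos_pos)
    moreover have "X_campanato_norm X N \<phi> f
        \<le> ennreal ((2 + 2 ^ CARD('n)) * 2 powr \<eta> * K * C) * campanato_norm \<phi> f"
      if "f \<in> L1_loc" for f
      using \<eta> by (intro X_campanato_le_campanato[OF pos K _ _ vec that]) auto
    ultimately show "\<exists>C::real. C > 0 \<and> (\<forall>f::real ^ 'n \<Rightarrow> 'k. f \<in> L1_loc \<longrightarrow>
      X_campanato_norm X N \<phi> f \<le> ennreal C * campanato_norm \<phi> f)"
      by blast
  qed
qed

end
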